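(* Let $(L,\leq,0,1)$ be a bounded lattice, $e\in L\setminus\{0,1\}$, and let $T_e$ be a $t$-norm on $[0,e]$. Let $U_T: L\times L\to L$ be defined by $$ U_T(x,y)=\begin{cases} T_e(x,y), & (x,y)\in [0,e]^2,\\ 1, & (x,y)\in (e,1]^2,\\ y, & (x,y)\in [0,e]\times I_e,\\ x, & (x,y)\in I_e\times [0,e],\\ x\vee y, & \text{otherwise.} \end{cases} $$ Then the following statements are equivalent: (i) $U_T$ is a uninorm on $L$ with the neutral element $e$; (ii) either $I_e=\emptyset$, or for any $y,z\in I_e$ it holds that $y\vee z\in I_e$ or $y\vee z=1$; (iii) $I_e\vee I_e\subset I_e\cup\{1\}$; (iv) $\vee$ is a $t$-conorm on $I_e\cup\{0,1\}$.
   Context: $(L,\leq,0,1)$ is a lattice with bottom element $0$ and top element $1$; $\wedge,\vee$ are infimum and supremum; $x<y$ means $x\leq y$ and $x\neq y$. For $a\leq b$, $[a,b]=\{x\in L: a\leq x\leq b\}$, and $[a,b)$, $(a,b]$, $(a,b)$ are defined similarly (with strict inequality $<$ at the open end). Elements $x,y$ are incomparable, written $x\| y$, if $x\nleq y$ and $y\nleq x$; $I_e=\{x\in L: x\| e\}$. $I_e\vee I_e=\{y\vee z: y,z\in I_e\}$. The symbol $\subset$ allows equality. A uninorm on $L$ is a binary operation $U:L^2\to L$ that is commutative, associative, increasing (i.e. order-preserving) in each variable, and has a neutral element $e\in L$, i.e. $U(e,x)=x$ for all $x\in L$. A $t$-norm (resp. $t$-conorm) is a commutative, associative operation, increasing in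 each variable, whose neutral element is the top (resp. bottom) element. Thus a $t$-norm on $[0,e]$ is such an operation $[0,e]^2\to[0,e]$ with neutral element $e$. That $\vee$ is a $t$-conorm on $I_e\cup\{0,1\}$ means that the restriction of $\vee$ to $(I_e\cup\{0,1\})^2$ takes values in $I_e\cup\{0,1\}$ and is commutative, associative, increasing in each variable (for the induced order) with neutral element $0$. *)

theory Defs
  imports Main
begin

text \<open>
  Uninorms, t-norms and t-conorms are defined relative to a carrier set \<open>A\<close> of an ordered
  type, with the induced order; values of the operation outside \<open>A \<times> A\<close> play no role.
\<close>

definition uninorm_on :: "'a::order set \<Rightarrow> ('a \<Rightarrow> 'a \<Rightarrow> 'a) \<Rightarrow> 'a \<Rightarrow> bool" where
  "uninorm_on A U e \<longleftrightarrow>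
     (\<forall>x\<in>A. \<forall>y\<in>A. U x y \<in> A) \<and>
     (\<forall>x\<in>A. \<forall>y\<in>A. U x y = U y x) \<and>
     (\<forall>x\<in>A. \<forall>y\<in>A. \<forall>z\<in>A. U (U x y) z = U x (U y z)) \<and>
     (\<forall>x\<in>A. \<forall>y\<in>A. \<forall>z\<in>A. x \<le> y \<longrightarrow> U x z \<le> U y z \<and> U z x \<le> U z y) \<and>
     e \<in> A \<and> (\<forall>x\<in>A. U e x = x)"

definition tnorm_on :: "'a::order set \<Rightarrow> ('a \<Rightarrow> 'a \<Rightarrow> 'a) \<Rightarrow> 'a \<Rightarrow> bool" where
  "tnorm_on A T t \<longleftrightarrow> uninorm_on A T t \<and> (\<forall>x\<in>A. x \<le> t)"

definition tconorm_on :: "'a::order set \<Rightarrow> ('a \<Rightarrow> 'a \<Rightarrow> 'a) \<Rightarrow> 'a \<Rightarrow> bool" where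
  "tconorm_on A S b \<longleftrightarrow> uninorm_on A S b \<and> (\<forall>x\<in>A. b \<le> x)"

definition incomparables :: "'a::order \<Rightarrow> 'a set" where
  "incomparables e = {x. \<not> x \<le> e \<and> \<not> e \<le> x}"

definition U_T :: "'a::bounded_lattice \<Rightarrow> ('a \<Rightarrow> 'a \<Rightarrow> 'a) \<Rightarrow> 'a \<Rightarrow> 'a \<Rightarrow> 'a" where
  "U_T e T x y =
     (if (x, y) \<in> {bot..e} \<times> {bot..e} then T x y
      else if (x, y) \<in> {e<..top} \<times> {e<..top} then top
      else if (x, y) \<in> {bot..e} \<times> incomparables e then y
      else if (x, y) \<in> incomparables e \<times> {bot..e} then x
      else sup x y)"

end

theory Submission
  imports Defs
begin

text \<open>
  Outside \<open>[0,e]\<close>, which is closed under \<open>U\<^sub>T\<close> and acts trivially on its complement, \<open>U\<^sub>T\<close> is the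
  join, except that two elements above \<open>e\<close> are sent to \<open>1\<close>. The only obstruction to associativity
  is hence a join of two incomparable elements that lies above \<open>e\<close> but is not \<open>1\<close>: for such
  \<open>w = y \<or> z\<close>, one has \<open>U(U(y,z),w) = 1\<close>, whereas \<open>U(y,U(z,w)) = w\<close>.
\<close>

lemma tnorm_on_interval:
  fixes e :: "'a::bounded_lattice"
  assumes "tnorm_on {bot..e} T e"
  shows tnorm_on_closed: "\<And>x y. x \<le> e \<Longrightarrow> y \<le> e \<Longrightarrow> T x y \<le> e"
    and tnorm_on_commute: "\<And>x y. x \<le> e \<Longrightarrow> y \<le> e \<Longrightarrow> T x y = T y x"
    and tnorm_on_assoc: "\<And>x y z. x \<le> e \<Longrightarrow> y \<le> e \<Longrightarrow> z \<le> e \<Longrightarrow> T (T x y) z = T x (T y z)"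
    and tnorm_on_mono: "\<And>x y z. y \<le> e \<Longrightarrow> z \<le> e \<Longrightarrow> x \<le> y \<Longrightarrow> T x z \<le> T y z"
    and tnorm_on_neutral: "\<And>x. x \<le> e \<Longrightarrow> T e x = x"
  using assms unfolding tnorm_on_def uninorm_on_def
  by (auto intro: order_trans)

lemma tnorm_on_le:
  fixes e :: "'a::bounded_lattice"
  assumes "tnorm_on {bot..e} T e" "x \<le> e" "y \<le> e"
  shows "T x y \<le> x"
proof -
  have "T x y = T y x"
    by (rule tnorm_on_commute[OF assms])
  also have "\<dots> \<le> T e x"
    using assms by (intro tnorm_on_mono[OF assms(1)]) auto
  also have "\<dots> = x"
    by (rule tnorm_on_neutral[OF assms(1,2)])
  finally show ?thesis .
qed

text \<open>If \<open>x\<close> \<le> \<open>e\<close> and \<open>y\<close> > \<open>e\<close>, the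
  fallback value \<open>sup x y\<close> is just \<open>y\<close>, the same as for an incomparable
  \<open>y\<close>. So only comparisons with \<open>e\<close> remain: an argument in
  \<open>[0,e]\<close> disappears next to one outside it.\<close>

lemma U_T_eq:
  "U_T e T x y =
     (if x \<le> e then if y \<le> e then T x y else y
      else if y \<le> e then x
      else if e \<le> x \<and> e \<le> y then top else sup x y)"
  by (auto simp: U_T_def incomparables_def less_le_not_le sup.absorb1 sup.absorb2
      dest: order_trans)

text \<open>An argument outside \<open>[0,e]\<close> lies below the value, which thus stays outside
  as well; \<open>e\<close> \<noteq> \<open>top\<close> keeps \<open>e\<close> itself from being an
  upper bound of everything.\<close>

lemma U_T_not_le:
  assumes "e \<noteq> top" "\<not> x \<le> e \<or> \<not> y \<le> e"
  shows "\<not> U_T e T x y \<le> e"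
  using assms by (auto simp: U_T_eq top_le)

lemma U_T_commute:
  assumes "tnorm_on {bot..e} T e"
  shows "U_T e T x y = U_T e T y x"
  using tnorm_on_commute[OF assms] by (auto simp: U_T_eq sup_commute)

lemma U_T_mono:
  assumes T: "tnorm_on {bot..e} T e" and "x \<le> y"
  shows "U_T e T x z \<le> U_T e T y z"
proof (cases "y \<le> e")
  case True
  then show ?thesis
    using \<open>x \<le> y\<close> tnorm_on_mono[OF T] by (auto simp: U_T_eq dest: order_trans)
next
  case False
  \<comment> \<open>This is the case where the first argument leaves \<open>[0,e]\<close> while
    \<open>z\<close> stays inside: the value jumps from \<open>T x z\<close> to
    \<open>y\<close>.\<close>
  have "T x z \<le> y" if "x \<le> e" "z \<le> e"
    using tnorm_on_le[OF T that] \<open>x \<le> y\<close> by (rule order_trans)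
  with False \<open>x \<le> y\<close> show ?thesis
    by (auto simp: U_T_eq le_supI1 intro: order_trans)
qed

lemma U_T_assoc:
  assumes T: "tnorm_on {bot..e} T e" and "e \<noteq> top"
    and join: "\<And>y z. y \<in> incomparables e \<Longrightarrow> z \<in> incomparables e \<Longrightarrow>
      sup y z \<in> incomparables e \<or> sup y z = top"
  shows "U_T e T (U_T e T x y) z = U_T e T x (U_T e T y z)"
proof -
  let ?U = "U_T e T"
  have absorb: "?U u v = v" "?U v u = v" if "u \<le> e" "\<not> v \<le> e" for u v
    using that by (auto simp: U_T_eq)
  consider (below) "x \<le> e" "y \<le> e" "z \<le> e"
    | (mixed) "x \<le> e \<or> y \<le> e \<or> z \<le> e" "\<not> (x \<le> e \<and> y \<le> e \<and> z \<le> e)"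
    | (outside) "\<not> x \<le> e" "\<not> y \<le> e" "\<not> z \<le> e" by blast
  then show ?thesis
  proof cases
    case below
    then show ?thesis
      using tnorm_on_closed[OF T] tnorm_on_assoc[OF T] by (simp add: U_T_eq)
  next
    case mixed
    \<comment> \<open>Inner values stay on the same side of \<open>[0,e]\<close> as their arguments
      dictate, so on both sides of the equation the arguments in \<open>[0,e]\<close> drop out by
      \<open>absorb\<close>.\<close>
    have "?U u v \<le> e" if "u \<le> e" "v \<le> e" for u v
      using tnorm_on_closed[OF T that] that by (simp add: U_T_eq)
    then show ?thesis
      using mixed U_T_not_le[OF \<open>e \<noteq> top\<close>, of _ _ T]
      by (metis absorb)
  next
    case outside
    \<comment> \<open>The right-hand side is symmetric in \<open>u\<close>, \<open>v\<close>,
      \<open>w\<close>: the value is \<open>top\<close> once two of them are above \<open>e\<close>,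
      and the join otherwise. Associativity then follows by rotating the arguments and using
      commutativity.\<close>
    have triple: "?U (?U u v) w =
        (if (e \<le> u \<and> e \<le> v) \<or> (e \<le> u \<and> e \<le> w) \<or> (e \<le> v \<and> e \<le> w) then top
         else sup (sup u v) w)"
      if "\<not> u \<le> e" "\<not> v \<le> e" "\<not> w \<le> e" for u v w
    proof (cases "e \<le> u \<or> e \<le> v")
      case True
      with that \<open>e \<noteq> top\<close> show ?thesis
        by (auto simp: U_T_eq top_le le_supI1 le_supI2)
    next
      case False
      \<comment> \<open>Here \<open>u\<close> and \<open>v\<close> are both incomparable to
        \<open>e\<close>. A join above \<open>e\<close> must be \<open>top\<close>, so collapsing it
        with \<open>w\<close> to \<open>top\<close> agrees with the plain triple join.\<close>
      with that have "e \<le> sup u v \<Longrightarrow> sup u v = top"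
        using join[of u v] by (auto simp: incomparables_def)
      with that False \<open>e \<noteq> top\<close> show ?thesis
        by (cases "e \<le> sup u v") (auto simp: U_T_eq top_le)
    qed
    have "?U (?U x y) z = ?U (?U y z) x"
      using outside by (simp add: triple conj_commute disj_commute disj_left_commute sup_commute sup_left_commute)
    also have "\<dots> = ?U x (?U y z)"
      by (rule U_T_commute[OF T])
    finally show ?thesis .
  qed
qed

lemma uninorm_on_U_T_iff:
  assumes T: "tnorm_on {bot..e} T e" and "e \<noteq> top"
  shows "uninorm_on UNIV (U_T e T) e \<longleftrightarrow>
    (\<forall>y\<in>incomparables e. \<forall>z\<in>incomparables e. sup y z \<in> incomparables e \<or> sup y z = top)"
    (is "?uninorm \<longleftrightarrow> ?join")
proof
  assume ?uninorm
  then have assoc: "\<forall>a\<in>UNIV. \<forall>b\<in>UNIV. \<forall>c\<in>UNIV.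
      U_T e T (U_T e T a b) c = U_T e T a (U_T e T b c)"
    unfolding uninorm_on_def by (elim conjE)
  show ?join
  proof (intro ballI)
    fix y z
    assume yz: "y \<in> incomparables e" "z \<in> incomparables e"
    define w where "w = sup y z"
    have nw: "\<not> w \<le> e"
      using yz by (auto simp: w_def incomparables_def)
    have "w = top" if "e \<le> w"
    proof -
      have "top = U_T e T (U_T e T y z) w"
        using yz nw that by (simp add: U_T_eq incomparables_def w_def[symmetric])
      also have "\<dots> = U_T e T y (U_T e T z w)"
        using assoc by blast
      \<comment> \<open>Neither \<open>y\<close> nor \<open>z\<close> is above \<open>e\<close>, so
        both applications are joins, which \<open>w\<close> absorbs.\<close>
      also have "\<dots> = w"
        using yz nw by (simp add: U_T_eq incomparables_def w_def sup.left_commute)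
      finally show ?thesis by simp
    qed
    with nw show "sup y z \<in> incomparables e \<or> sup y z = top"
      by (auto simp: incomparables_def w_def)
  qed
next
  assume ?join
  have neutral: "U_T e T e x = x" for x
    using tnorm_on_neutral[OF T] by (auto simp: U_T_eq)
  show ?uninorm
    unfolding uninorm_on_def
  proof (intro conjI ballI impI UNIV_I)
    show "U_T e T x y = U_T e T y x" for x y
      by (rule U_T_commute[OF T])
    show "U_T e T (U_T e T x y) z = U_T e T x (U_T e T y z)" for x y z
      using \<open>?join\<close> by (intro U_T_assoc[OF T \<open>e \<noteq> top\<close>]) blast
    show "U_T e T x z \<le> U_T e T y z" if "x \<le> y" for x y z
      by (rule U_T_mono[OF T that])
    then show "U_T e T z x \<le> U_T e T z y" if "x \<le> y" for x y z
      using that by (simp add: U_T_commute[OF T, of z])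
  qed (rule neutral)
qed

lemma tconorm_on_sup_iff:
  fixes e :: "'a::bounded_lattice"
  shows "tconorm_on (incomparables e \<union> {bot, top}) sup bot \<longleftrightarrow>
    (\<forall>y\<in>incomparables e. \<forall>z\<in>incomparables e. sup y z \<in> incomparables e \<or> sup y z = top)"
    (is "?tconorm \<longleftrightarrow> ?join")
proof
  assume ?tconorm
  then have "\<forall>y\<in>incomparables e \<union> {bot, top}. \<forall>z\<in>incomparables e \<union> {bot, top}.
      sup y z \<in> incomparables e \<union> {bot, top}"
    unfolding tconorm_on_def uninorm_on_def by (elim conjE)
  \<comment> \<open>Closure allows the value \<open>bot\<close> too; it is excluded because
    \<open>bot\<close> is comparable to \<open>e\<close>.\<close>
  moreover have "sup y z \<noteq> bot" if "y \<in> incomparables e" for y z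
    using that by (auto simp: incomparables_def)
  ultimately show ?join by blast
next
  assume ?join
  then show ?tconorm
    unfolding tconorm_on_def uninorm_on_def
    by (intro conjI ballI impI sup_commute sup_assoc sup_mono order_refl) auto
qed

theorem theorem8:
  fixes e :: "'a::bounded_lattice" and T :: "'a \<Rightarrow> 'a \<Rightarrow> 'a"
  assumes "e \<notin> {bot, top}"
    and "tnorm_on {bot..e} T e"
  shows "(uninorm_on UNIV (U_T e T) e \<longleftrightarrow>
           incomparables e = {} \<or>
           (\<forall>y\<in>incomparables e. \<forall>z\<in>incomparables e. sup y z \<in> incomparables e \<or> sup y z = top)) \<and>
         (uninorm_on UNIV (U_T e T) e \<longleftrightarrow>
           {sup y z | y z. y \<in> incomparables e \<and> z \<in> incomparables e} \<subseteq> incomparables e \<union> {top}) \<and>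
         (uninorm_on UNIV (U_T e T) e \<longleftrightarrow>
           tconorm_on (incomparables e \<union> {bot, top}) sup bot)"
proof -
  have "e \<noteq> top" using assms(1) by simp
  then show ?thesis
    \<comment> \<open>All statements become the same join condition, which holds vacuously when
      \<open>incomparables e\<close> is empty.\<close>
    unfolding uninorm_on_U_T_iff[OF assms(2) \<open>e \<noteq> top\<close>] tconorm_on_sup_iff
    by auto
qed

end
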